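(* Let $A:S^1\to\mathbb{R}$ be a Lipschitz continuous function having a unique maximizing probability, and let $\mathcal{G}=\mathcal{G}_A:\mathcal{C}\to\mathcal{C}$ be the associated operator. Let $f_0,g_0\in\mathcal{C}$ and assume $(f_0,g_0)\in\mathfrak{A}$. If $|\mathcal{G}(f_0)-\mathcal{G}(g_0)|=|f_0-g_0|$, then $f_0=g_0$.
   Context: $S^1=\mathbb{R}/\mathbb{Z}$, $T(x)=2x \pmod 1$ is the doubling map, with inverse branches $\tau_i(x)=\frac12(x+i-1)$, $i=1,2$ (for $x\in[0,1]$). A maximizing probability for $A$ is a $T$-invariant probability $\mu$ with $\int A\,d\mu=m(A):=\sup_{\rho\ T\text{-invariant}}\int A\,d\rho$. $C^0$ is the space of continuous functions $S^1\to\mathbb{R}$ with $|f|_0=\sup|f|$, and $\mathcal{C}=C^0/\mathbb{R}$ is its quotient by the constants; in each class the representative with supremum $0$ is chosen. $\mathcal{C}$ carries the quotient norm $|f|=\inf_{\alpha\in\mathbb{R}}|f+\alpha|_0$. The infimum is attained at $\alpha_f:=-\frac{\max f+\min f}{2}$, so $|f|=|f+\alpha_f|_0$. The operator $\mathcal{G}_A:\mathcal{C}\to\mathcal{C}$ is $$\mathcal{G}_A(f)(x)=\frac{\max_{T(y)=x}[A(y)+f(y)]+f(x)}{2}-c_f,\qquad c_f=\sup_{s\in S^1}\frac{\max_{T(r)=s}[A(r)+f(r)]+f(s)}{2}.$$ $\mathfrak{A}\subset\mathcal{C}\times\mathcal{C}$ is the set of pairs $(f_0,g_0)$ such that, for every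 $r$ with $|f_0-g_0|=|(f_0-g_0)+\alpha_{f_0-g_0}|_0=(f_0-g_0)(r)+\alpha_{f_0-g_0}$, one has $(f_0-g_0)(r)\neq(f_0-g_0)(\tau_1(r))$ and $(f_0-g_0)(r)\neq(f_0-g_0)(\tau_2(r))$. *)

theory Defs
  imports "HOL-Probability.Probability"
begin

section \<open>The circle\<close>

quotient_type circle = real / "\<lambda>x y :: real. x - y \<in> \<int>"
  morphisms rep_circle to_circle
proof (rule equivpI)
  show "reflp (\<lambda>x y :: real. x - y \<in> \<int>)"
    by (simp add: reflp_def)
  show "symp (\<lambda>x y :: real. x - y \<in> \<int>)"
    by (metis (no_types, lifting) Ints_minus minus_diff_eq sympI)
  show "transp (\<lambda>x y :: real. x - y \<in> \<int>)"
    by (rule transpI) (metis Ints_add diff_add_cancel add_diff_eq)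
qed

lemma to_circle_eq_iff: "to_circle x = to_circle y \<longleftrightarrow> x - y \<in> \<int>"
  by (rule circle.abs_eq_iff)

lemma to_circle_cases: obtains a where "x = to_circle a"
  using circle.abs_induct[of "\<lambda>x. \<exists>a. x = to_circle a" x] by blast

lemma INF_round: "(INF n::int. \<bar>z + of_int n\<bar>) = \<bar>z - of_int (round z)\<bar>" for z :: real
proof (rule antisym)
  have bdd: "bdd_below (range (\<lambda>n::int. \<bar>z + of_int n\<bar>))"
    by (rule bdd_belowI[of _ 0]) auto
  show "(INF n::int. \<bar>z + of_int n\<bar>) \<le> \<bar>z - of_int (round z)\<bar>"
    using cINF_lower[OF bdd, of "- round z"] by simp
  show "\<bar>z - of_int (round z)\<bar> \<le> (INF n::int. \<bar>z + of_int n\<bar>)"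
  proof (rule cINF_greatest)
    fix n :: int
    show "\<bar>z - of_int (round z)\<bar> \<le> \<bar>z + of_int n\<bar>"
      using round_diff_minimal[of z "- n"] by simp
  qed simp
qed

instantiation circle :: metric_space
begin

lift_definition dist_circle :: "circle \<Rightarrow> circle \<Rightarrow> real"
  is "\<lambda>x y. INF n::int. \<bar>x - y + of_int n\<bar>"
proof -
  fix x x' y y' :: real
  assume "x - x' \<in> \<int>" "y - y' \<in> \<int>"
  then obtain k where k: "(x - x') - (y - y') = of_int k"
    by (meson Ints_cases Ints_diff)
  have "range (\<lambda>n::int. \<bar>x - y + of_int n\<bar>) = range (\<lambda>n::int. \<bar>x' - y' + of_int n\<bar>)"
  proof (intro antisym subsetI)
    fix t assume "t \<in> range (\<lambda>n::int. \<bar>x - y + of_int n\<bar>)"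
    then obtain n :: int where "t = \<bar>x - y + of_int n\<bar>" by auto
    also have "x - y + of_int n = x' - y' + of_int (n + k)" using k by simp
    finally show "t \<in> range (\<lambda>n::int. \<bar>x' - y' + of_int n\<bar>)" by blast
  next
    fix t assume "t \<in> range (\<lambda>n::int. \<bar>x' - y' + of_int n\<bar>)"
    then obtain n :: int where "t = \<bar>x' - y' + of_int n\<bar>" by auto
    also have "x' - y' + of_int n = x - y + of_int (n - k)" using k by simp
    finally show "t \<in> range (\<lambda>n::int. \<bar>x - y + of_int n\<bar>)" by blast
  qed
  then show "(INF n::int. \<bar>x - y + of_int n\<bar>) = (INF n::int. \<bar>x' - y' + of_int n\<bar>)"
    by simp
qed

definition uniformity_circle :: "(circle \<times> circle) filter"
  where "uniformity_circle = (INF e\<in>{0 <..}. principal {(x, y). dist x y < e})"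

definition open_circle :: "circle set \<Rightarrow> bool"
  where "open_circle S = (\<forall>x\<in>S. \<forall>\<^sub>F (x', y) in uniformity. x' = x \<longrightarrow> y \<in> S)"

instance
proof
  have eq: "dist (to_circle a) (to_circle b) = \<bar>a - b - of_int (round (a - b))\<bar>" for a b
    by (simp add: dist_circle.abs_eq INF_round)
  fix x y z :: circle
  obtain a b c where abc: "x = to_circle a" "y = to_circle b" "z = to_circle c"
    by (metis to_circle_cases)
  show "dist x y = 0 \<longleftrightarrow> x = y"
    unfolding abc eq to_circle_eq_iff
    by (metis Ints_cases Ints_of_int abs_0 abs_eq_0 diff_self eq_iff_diff_eq_0 round_of_int)
  have "\<bar>a - b - of_int (round (a - b))\<bar> \<le> \<bar>a - b - of_int (round (a - c) - round (b - c))\<bar>"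
    by (rule round_diff_minimal)
  also have "\<dots> = \<bar>(a - c - of_int (round (a - c))) - (b - c - of_int (round (b - c)))\<bar>"
    by simp
  also have "\<dots> \<le> \<bar>a - c - of_int (round (a - c))\<bar> + \<bar>b - c - of_int (round (b - c))\<bar>"
    by (rule abs_triangle_ineq4)
  finally show "dist x y \<le> dist x z + dist y z"
    unfolding abc eq .
qed (rule uniformity_circle_def open_circle_def)+

end

lemma dist_to_circle: "dist (to_circle a) (to_circle b) = \<bar>a - b - of_int (round (a - b))\<bar>"
  by (simp add: dist_circle.abs_eq INF_round)

lemma dist_to_circle_le: "dist (to_circle a) (to_circle b) \<le> \<bar>a - b\<bar>"
  using round_diff_minimal[of "a - b" 0] by (simp add: dist_to_circle)

lemma circle_near_rep:
  obtains b where "y = to_circle b" "dist (to_circle a) y = \<bar>a - b\<bar>"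
proof -
  obtain b' where b': "y = to_circle b'" by (metis to_circle_cases)
  define b where "b = b' + of_int (round (a - b'))"
  have "y = to_circle b"
    by (simp add: b' to_circle_eq_iff b_def)
  moreover have "dist (to_circle a) y = \<bar>a - b\<bar>"
    by (simp add: b' dist_to_circle b_def algebra_simps)
  ultimately show ?thesis using that by blast
qed

lemma continuous_to_circle: "continuous_on S to_circle"
  unfolding continuous_on_iff
  by (metis dist_commute dist_real_def dist_to_circle_le le_less_trans)

lemma continuous_on_circleI:
  fixes g :: "circle \<Rightarrow> 'a :: metric_space"
  assumes "continuous_on UNIV (\<lambda>a. g (to_circle a))"
  shows "continuous_on UNIV g"
  unfolding continuous_on_iff
proof safe
  fix x :: circle and e :: real
  assume "0 < e"
  obtain a where a: "x = to_circle a" by (metis to_circle_cases)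
  obtain d where d: "d > 0" "\<And>b. dist b a < d \<Longrightarrow> dist (g (to_circle b)) (g (to_circle a)) < e"
    using assms \<open>0 < e\<close> unfolding continuous_on_iff by blast
  show "\<exists>d>0. \<forall>x'\<in>UNIV. dist x' x < d \<longrightarrow> dist (g x') (g x) < e"
  proof (intro exI conjI ballI impI)
    fix y assume y: "dist y x < d"
    obtain b where b: "y = to_circle b" "dist (to_circle a) y = \<bar>a - b\<bar>"
      by (rule circle_near_rep)
    then have "dist b a < d"
      using y by (simp add: a dist_commute dist_real_def)
    then show "dist (g y) (g x) < e"
      using d(2) by (simp add: a b(1))
  qed (rule d)
qed

lemma to_circle_frac: "to_circle (frac a) = to_circle a"
  by (simp add: to_circle_eq_iff frac_def)

lemma compact_UNIV_circle: "compact (UNIV :: circle set)"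
proof -
  have "(UNIV :: circle set) = to_circle ` {0..1}"
  proof (intro antisym subsetI)
    fix x :: circle
    obtain a where "x = to_circle a" by (metis to_circle_cases)
    then have "x = to_circle (frac a)" by (simp add: to_circle_frac)
    moreover have "frac a \<in> {0..1}" using frac_lt_1[of a] by simp
    ultimately show "x \<in> to_circle ` {0..1}" by blast
  qed simp
  then show ?thesis
    by (metis compact_continuous_image compact_Icc continuous_to_circle)
qed

lift_definition coord :: "circle \<Rightarrow> real" is frac
  by (metis Ints_cases diff_add_cancel frac_add_of_int_left)

lift_definition doubling :: "circle \<Rightarrow> circle" is "\<lambda>x. 2 * x"
  by (metis Ints_mult Ints_numeral right_diff_distrib)

text \<open>
  The inverse branches, for i = 1, 2, evaluated at the coordinate in the half-open unit interval.
  Evaluating them at coordinate 1 instead of 0 interchanges the two preimages of the base point.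
\<close>

definition inv_branch :: "nat \<Rightarrow> circle \<Rightarrow> circle" where
  "inv_branch i x = to_circle ((coord x + real i - 1) / 2)"

lemma doubling_to_circle_vimage:
  "{y. doubling y = to_circle a} = {to_circle (a / 2), to_circle ((a + 1) / 2)}"
proof (intro antisym subsetI)
  fix y assume "y \<in> {y. doubling y = to_circle a}"
  moreover obtain b where b: "y = to_circle b" by (metis to_circle_cases)
  ultimately have "2 * b - a \<in> \<int>"
    by (simp add: doubling.abs_eq to_circle_eq_iff)
  then obtain n where n: "2 * b - a = of_int n" by (meson Ints_cases)
  show "y \<in> {to_circle (a / 2), to_circle ((a + 1) / 2)}"
  proof (cases "even n")
    case True
    then obtain k where "n = 2 * k" by blast
    then have "b - a / 2 = of_int k" using n by simp
    then show ?thesis by (simp add: b to_circle_eq_iff)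
  next
    case False
    then obtain k where "n = 2 * k + 1" by (meson oddE)
    then have "b - (a + 1) / 2 = of_int k" using n by (simp add: field_simps)
    then show ?thesis by (simp add: b to_circle_eq_iff)
  qed
next
  have "(2 * a + 2) / 2 - a = 1" by (simp add: field_simps)
  moreover fix y assume "y \<in> {to_circle (a / 2), to_circle ((a + 1) / 2)}"
  ultimately show "y \<in> {y. doubling y = to_circle a}"
    by (auto simp: doubling.abs_eq to_circle_eq_iff)
qed

lemma doubling_vimage: "{y. doubling y = x} = {inv_branch 1 x, inv_branch 2 x}"
proof -
  have "x = to_circle (coord x)"
    by (metis to_circle_cases coord.abs_eq to_circle_frac)
  then show ?thesis
    using doubling_to_circle_vimage[of "coord x"] by (simp add: inv_branch_def add.commute)
qed


section \<open>Continuous functions and their quotient by the constants\<close>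

text \<open>
  As the circle is compact, bounded continuous functions are all the continuous functions, and
  their norm is the supremum norm.
\<close>

type_synonym C0 = "circle \<Rightarrow>\<^sub>C real"

lemma continuous_circle_bcontfun: "continuous_on UNIV f \<Longrightarrow> f \<in> bcontfun" for f :: "circle \<Rightarrow> real"
  by (simp add: bcontfun_def compact_continuous_image compact_imp_bounded compact_UNIV_circle)

quotient_type C0_mod = C0 / "\<lambda>f g :: C0. \<exists>c. f - g = const_bcontfun c"
  morphisms rep_C0_mod to_C0_mod
proof (rule equivpI)
  show "reflp (\<lambda>f g :: C0. \<exists>c. f - g = const_bcontfun c)"
    by (rule reflpI) (metis const_bcontfun_0_eq_0 diff_self)
  show "symp (\<lambda>f g :: C0. \<exists>c. f - g = const_bcontfun c)"
  proof (rule sympI, elim exE)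
    fix f g :: C0 and c assume "f - g = const_bcontfun c"
    then have "g - f = const_bcontfun (- c)"
      by (auto intro!: bcontfun_eqI dest!: arg_cong[of _ _ apply_bcontfun] simp: fun_eq_iff)
         (metis minus_diff_eq)
    then show "\<exists>c. g - f = const_bcontfun c" by blast
  qed
  show "transp (\<lambda>f g :: C0. \<exists>c. f - g = const_bcontfun c)"
  proof (rule transpI, elim exE)
    fix f g h :: C0 and c d assume "f - g = const_bcontfun c" "g - h = const_bcontfun d"
    then have "f - h = const_bcontfun c + const_bcontfun d"
      by (metis add_diff_eq diff_add_cancel)
    also have "\<dots> = const_bcontfun (c + d)"
      by (rule bcontfun_eqI) simp
    finally show "\<exists>c. f - h = const_bcontfun c" by blast
  qed
qed

lemma const_bcontfun_add: "const_bcontfun c + const_bcontfun d = (const_bcontfun (c + d) :: C0)"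
  by (rule bcontfun_eqI) simp

lemma const_bcontfun_uminus: "- const_bcontfun c = (const_bcontfun (- c) :: C0)"
  by (rule bcontfun_eqI) simp

lemma const_bcontfun_diff: "const_bcontfun c - const_bcontfun d = (const_bcontfun (c - d) :: C0)"
  by (rule bcontfun_eqI) simp

lemma const_bcontfun_scaleR: "r *\<^sub>R const_bcontfun c = (const_bcontfun (r * c) :: C0)"
  by (rule bcontfun_eqI) simp

lemma to_C0_mod_cases: obtains f where "F = to_C0_mod f"
  using C0_mod.abs_induct[of "\<lambda>F. \<exists>f. F = to_C0_mod f" F] by blast

instantiation C0_mod :: real_vector
begin

lift_definition zero_C0_mod :: C0_mod is 0 .

lift_definition plus_C0_mod :: "C0_mod \<Rightarrow> C0_mod \<Rightarrow> C0_mod" is "(+)"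
  by (metis add_diff_add const_bcontfun_add)

lift_definition uminus_C0_mod :: "C0_mod \<Rightarrow> C0_mod" is uminus
  by (metis const_bcontfun_uminus minus_diff_commute minus_diff_minus)

lift_definition minus_C0_mod :: "C0_mod \<Rightarrow> C0_mod \<Rightarrow> C0_mod" is "(-)"
proof -
  fix f f' g g' :: C0
  assume "\<exists>c. f - f' = const_bcontfun c" "\<exists>c. g - g' = const_bcontfun c"
  then obtain c d where "f - f' = const_bcontfun c" "g - g' = const_bcontfun d" by blast
  moreover have "f - g - (f' - g') = (f - f') - (g - g')" by simp
  ultimately have "f - g - (f' - g') = const_bcontfun (c - d)"
    by (metis const_bcontfun_diff)
  then show "\<exists>c. f - g - (f' - g') = const_bcontfun c" by blast
qed

lift_definition scaleR_C0_mod :: "real \<Rightarrow> C0_mod \<Rightarrow> C0_mod" is "(*\<^sub>R)"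
  by (metis const_bcontfun_scaleR real_vector.scale_right_diff_distrib)

instance
proof
  fix F G H :: C0_mod and a b :: real
  obtain f g h where [simp]: "F = to_C0_mod f" "G = to_C0_mod g" "H = to_C0_mod h"
    by (metis to_C0_mod_cases)
  note [simp] = zero_C0_mod_def plus_C0_mod.abs_eq uminus_C0_mod.abs_eq minus_C0_mod.abs_eq
    scaleR_C0_mod.abs_eq
  show "F + G + H = F + (G + H)" by (simp add: add.assoc)
  show "F + G = G + F" by (simp add: add.commute)
  show "0 + F = F" by simp
  show "- F + F = 0" by simp
  show "F - G = F + - G" by simp
  show "a *\<^sub>R (F + G) = a *\<^sub>R F + a *\<^sub>R G" by (simp add: scaleR_add_right)
  show "(a + b) *\<^sub>R F = a *\<^sub>R F + b *\<^sub>R F" by (simp add: scaleR_add_left)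
  show "a *\<^sub>R b *\<^sub>R F = (a * b) *\<^sub>R F" by simp
  show "1 *\<^sub>R F = F" by simp
qed

end

lemma bdd_below_norm_shift: "bdd_below (range (\<lambda>\<alpha>. norm (f + const_bcontfun \<alpha> :: C0)))"
  by (rule bdd_belowI[of _ 0]) auto

instantiation C0_mod :: real_normed_vector
begin

lift_definition norm_C0_mod :: "C0_mod \<Rightarrow> real"
  is "\<lambda>f. INF \<alpha>::real. norm (f + const_bcontfun \<alpha>)"
proof -
  fix f g :: C0
  assume "\<exists>c. f - g = const_bcontfun c"
  then obtain c where c: "f = g + const_bcontfun c" by (metis add.commute diff_add_cancel)
  have "range (\<lambda>\<alpha>. norm (f + const_bcontfun \<alpha>)) = (\<lambda>\<alpha>. norm (g + const_bcontfun \<alpha>)) ` range ((+) c)"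
    by (simp only: c image_image add.assoc const_bcontfun_add)
  also have "range ((+) c) = UNIV" by (rule surj_plus)
  finally show "(INF \<alpha>::real. norm (f + const_bcontfun \<alpha>)) = (INF \<alpha>::real. norm (g + const_bcontfun \<alpha>))"
    by simp
qed

definition sgn_C0_mod :: "C0_mod \<Rightarrow> C0_mod"
  where "sgn_C0_mod F = F /\<^sub>R norm F"

definition dist_C0_mod :: "C0_mod \<Rightarrow> C0_mod \<Rightarrow> real"
  where "dist_C0_mod F G = norm (F - G)"

definition uniformity_C0_mod :: "(C0_mod \<times> C0_mod) filter"
  where "uniformity_C0_mod = (INF e\<in>{0 <..}. principal {(x, y). dist x y < e})"

definition open_C0_mod :: "C0_mod set \<Rightarrow> bool"
  where "open_C0_mod S = (\<forall>x\<in>S. \<forall>\<^sub>F (x', y) in uniformity. x' = x \<longrightarrow> y \<in> S)"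

instance
proof
  have le: "norm (to_C0_mod f) \<le> norm (f + const_bcontfun \<alpha>)" for f \<alpha>
    by (simp add: norm_C0_mod.abs_eq cINF_lower[OF bdd_below_norm_shift])
  have ge: "m \<le> norm (to_C0_mod f)" if "\<And>\<alpha>. m \<le> norm (f + const_bcontfun \<alpha>)" for f m
    by (simp add: norm_C0_mod.abs_eq cINF_greatest that)
  fix F G :: C0_mod and a :: real
  obtain f g where fg: "F = to_C0_mod f" "G = to_C0_mod g"
    by (metis to_C0_mod_cases)
  show "norm F = 0 \<longleftrightarrow> F = 0"
  proof
    assume 0: "norm F = 0"
    have "\<bar>f x - f y\<bar> / 2 \<le> norm F" for x y
      unfolding fg
    proof (rule ge)
      fix \<alpha>
      have "\<bar>f x + \<alpha>\<bar> \<le> norm (f + const_bcontfun \<alpha>)" "\<bar>f y + \<alpha>\<bar> \<le> norm (f + const_bcontfun \<alpha>)"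
        using norm_bounded[of "f + const_bcontfun \<alpha>"] by (metis const_bcontfun.rep_eq
            plus_bcontfun.rep_eq real_norm_def)+
      then have "f x + \<alpha> \<le> norm (f + const_bcontfun \<alpha>)" "- (f x + \<alpha>) \<le> norm (f + const_bcontfun \<alpha>)"
        "f y + \<alpha> \<le> norm (f + const_bcontfun \<alpha>)" "- (f y + \<alpha>) \<le> norm (f + const_bcontfun \<alpha>)"
        by (simp_all only: abs_le_iff)
      then have "f x - f y \<le> 2 * norm (f + const_bcontfun \<alpha>)" "f y - f x \<le> 2 * norm (f + const_bcontfun \<alpha>)"
        by linarith+
      then show "\<bar>f x - f y\<bar> / 2 \<le> norm (f + const_bcontfun \<alpha>)"
        by (simp add: abs_le_iff)
    qed
    then have "f x = f y" for x y
      using 0 by (metis abs_le_zero_iff diff_gt_0_iff_gt divide_le_0_iff eq_iff_diff_eq_0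
          not_numeral_le_zero)
    then have "f - 0 = const_bcontfun (f undefined)"
      by (auto intro!: bcontfun_eqI)
    then have "\<exists>c. f - 0 = const_bcontfun c" by blast
    then show "F = 0"
      unfolding fg zero_C0_mod_def by (simp only: C0_mod.abs_eq_iff)
  next
    assume "F = 0"
    then have "norm F \<le> 0" using le[of 0 0] by (simp add: zero_C0_mod_def)
    moreover have "0 \<le> norm F" unfolding fg by (rule ge) simp
    ultimately show "norm F = 0" by simp
  qed
  show "norm (F + G) \<le> norm F + norm G"
  proof -
    have *: "norm (F + G) \<le> norm (f + const_bcontfun \<alpha>) + norm (g + const_bcontfun \<beta>)" for \<alpha> \<beta>
    proof -
      have "norm (F + G) \<le> norm ((f + g) + const_bcontfun (\<alpha> + \<beta>))"
        unfolding fg plus_C0_mod.abs_eq by (rule le)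
      also have "(f + g) + const_bcontfun (\<alpha> + \<beta>) = (f + const_bcontfun \<alpha>) + (g + const_bcontfun \<beta>)"
        by (simp add: const_bcontfun_add[symmetric] algebra_simps)
      also have "norm \<dots> \<le> norm (f + const_bcontfun \<alpha>) + norm (g + const_bcontfun \<beta>)"
        by (rule norm_triangle_ineq)
      finally show ?thesis .
    qed
    have "norm (F + G) - norm (f + const_bcontfun \<alpha>) \<le> norm G" for \<alpha>
      unfolding fg(2) using *[of \<alpha>] by (intro ge) (simp add: fg algebra_simps)
    then have "norm (F + G) - norm G \<le> norm F"
      unfolding fg(1) by (intro ge) (simp add: fg algebra_simps)
    then show ?thesis by simp
  qed
  have scale_le: "norm (b *\<^sub>R to_C0_mod h) \<le> \<bar>b\<bar> * norm (to_C0_mod h)" if "b \<noteq> 0" for b h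
  proof -
    have "norm (b *\<^sub>R to_C0_mod h) / \<bar>b\<bar> \<le> norm (to_C0_mod h)"
    proof (rule ge)
      fix \<alpha>
      have "norm (b *\<^sub>R to_C0_mod h) \<le> norm (b *\<^sub>R h + const_bcontfun (b * \<alpha>))"
        unfolding scaleR_C0_mod.abs_eq by (rule le)
      also have "\<dots> = \<bar>b\<bar> * norm (h + const_bcontfun \<alpha>)"
        by (metis const_bcontfun_scaleR norm_scaleR scaleR_add_right)
      finally show "norm (b *\<^sub>R to_C0_mod h) / \<bar>b\<bar> \<le> norm (h + const_bcontfun \<alpha>)"
        using that by (simp add: field_simps)
    qed
    then show ?thesis using that by (simp add: field_simps)
  qed
  show "norm (a *\<^sub>R F) = \<bar>a\<bar> * norm F"
  proof (cases "a = 0")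
    case True
    have "norm (0 :: C0_mod) = 0"
      using le[of 0 0] ge[of 0 0] by (simp add: zero_C0_mod_def)
    then show ?thesis using True by simp
  next
    case False
    have "norm F = norm ((1 / a) *\<^sub>R (a *\<^sub>R F))" using False by simp
    also have "\<dots> \<le> \<bar>1 / a\<bar> * norm (a *\<^sub>R F)"
      using scale_le[of "1 / a" "a *\<^sub>R f"] False by (simp only: fg scaleR_C0_mod.abs_eq) simp
    finally have "\<bar>a\<bar> * norm F \<le> norm (a *\<^sub>R F)" using False by (simp add: field_simps)
    with scale_le[OF False, of f] show ?thesis by (simp add: fg)
  qed
qed (rule sgn_C0_mod_def dist_C0_mod_def uniformity_C0_mod_def open_C0_mod_def)+

end

lemma SUP_add_const:
  fixes g :: "'a \<Rightarrow> real"
  assumes "bdd_above (range g)"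
  shows "(SUP x. g x + c) = (SUP x. g x) + c"
proof (rule cSup_eq_non_empty)
  fix t assume "t \<in> range (\<lambda>x. g x + c)"
  then show "t \<le> (SUP x. g x) + c"
    using cSUP_upper[OF _ assms] by auto
next
  fix u assume u: "\<And>t. t \<in> range (\<lambda>x. g x + c) \<Longrightarrow> t \<le> u"
  have "(SUP x. g x) \<le> u - c"
    by (rule cSUP_least) (use u in \<open>auto simp: algebra_simps\<close>)
  then show "(SUP x. g x) + c \<le> u" by simp
qed simp

lift_definition sup0_rep :: "C0_mod \<Rightarrow> C0" is "\<lambda>f :: C0. f - const_bcontfun (SUP x. apply_bcontfun f x)"
proof -
  fix f g :: C0
  assume "\<exists>c. f - g = const_bcontfun c"
  then obtain c where c: "f = g + const_bcontfun c" by (metis add.commute diff_add_cancel)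
  have "(SUP x. g x + c) = (SUP x. g x) + c"
    by (rule SUP_add_const) (simp add: bounded_imp_bdd_above)
  then show "f - const_bcontfun (SUP x. apply_bcontfun f x) = g - const_bcontfun (SUP x. apply_bcontfun g x)"
    by (intro bcontfun_eqI) (simp add: c)
qed

lemma to_C0_mod_sup0_rep: "to_C0_mod (sup0_rep F) = F"
proof -
  obtain f where f: "F = to_C0_mod f" by (metis to_C0_mod_cases)
  have "sup0_rep F - f = const_bcontfun (- (SUP x. apply_bcontfun f x))"
    by (simp add: f sup0_rep.abs_eq const_bcontfun_uminus[symmetric])
  then show ?thesis unfolding f C0_mod.abs_eq_iff by blast
qed

definition alpha :: "C0 \<Rightarrow> real" where
  "alpha f = - (((SUP x. f x) + (INF x. f x)) / 2)"

lemma norm_to_C0_mod: "norm (to_C0_mod f) = norm (f + const_bcontfun (alpha f))"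
proof (rule antisym)
  show "norm (to_C0_mod f) \<le> norm (f + const_bcontfun (alpha f))"
    by (simp add: norm_C0_mod.abs_eq cINF_lower[OF bdd_below_norm_shift])
  have bdd: "bdd_above (range f)" "bdd_below (range f)"
    by (simp_all add: bounded_imp_bdd_above bounded_imp_bdd_below)
  have "norm (f + const_bcontfun (alpha f)) \<le> norm (f + const_bcontfun a)" for a
  proof -
    have *: "\<bar>f x + a\<bar> \<le> norm (f + const_bcontfun a)" for x
      using norm_bounded[of "f + const_bcontfun a" x] by simp
    have 1: "(SUP x. f x) \<le> norm (f + const_bcontfun a) - a"
      by (rule cSUP_least) (use * in \<open>auto simp: abs_le_iff algebra_simps\<close>)
    have 2: "- norm (f + const_bcontfun a) - a \<le> (INF x. f x)"
    proof (rule cINF_greatest)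
      fix x show "- norm (f + const_bcontfun a) - a \<le> f x"
        using *[of x] by linarith
    qed simp
    show ?thesis
    proof (rule norm_bound)
      fix x
      have "f x \<le> (SUP x. f x)" "(INF x. f x) \<le> f x"
        using cSUP_upper[OF _ bdd(1)] cINF_lower[OF bdd(2)] by auto
      then show "norm ((f + const_bcontfun (alpha f)) x) \<le> norm (f + const_bcontfun a)"
        using 1 2 by (simp add: alpha_def abs_le_iff field_simps)
    qed
  qed
  then show "norm (f + const_bcontfun (alpha f)) \<le> norm (to_C0_mod f)"
    by (simp add: norm_C0_mod.abs_eq cINF_greatest)
qed


section \<open>Maximizing probabilities\<close>

definition invariant_prob :: "circle measure \<Rightarrow> bool" where
  "invariant_prob \<mu> \<longleftrightarrow> prob_space \<mu> \<and> sets \<mu> = sets borel \<and> distr \<mu> borel doubling = \<mu>"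

definition max_value :: "(circle \<Rightarrow> real) \<Rightarrow> real" where
  "max_value A = (SUP \<rho>\<in>{\<rho>. invariant_prob \<rho>}. \<integral>x. A x \<partial>\<rho>)"

definition maximizing :: "(circle \<Rightarrow> real) \<Rightarrow> circle measure \<Rightarrow> bool" where
  "maximizing A \<mu> \<longleftrightarrow> invariant_prob \<mu> \<and> (\<integral>x. A x \<partial>\<mu>) = max_value A"

lemma continuous_doubling: "continuous_on S doubling"
proof -
  have "continuous_on UNIV (\<lambda>a. to_circle (2 * a))"
    by (rule continuous_on_compose2[OF continuous_to_circle[of UNIV]]) (auto intro: continuous_intros)
  then have "continuous_on UNIV doubling"
    by (intro continuous_on_circleI) (simp add: doubling.abs_eq)
  then show ?thesis by (rule continuous_on_subset) simp
qed

text \<open>The supremum is over a nonempty bounded set of reals.\<close>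

lemma invariant_prob_nonempty: "\<exists>\<rho>. invariant_prob \<rho>"
proof
  have "doubling (to_circle 0) = to_circle 0" by (simp add: doubling.abs_eq)
  moreover have "doubling \<in> measurable borel borel"
    by (intro borel_measurable_continuous_onI continuous_doubling)
  ultimately show "invariant_prob (return borel (to_circle 0))"
    by (simp add: invariant_prob_def prob_space_return distr_return)
qed

lemma max_value_bdd:
  fixes A :: C0
  shows "bdd_above ((\<lambda>\<rho>. \<integral>x. A x \<partial>\<rho>) ` {\<rho>. invariant_prob \<rho>})"
proof (rule bdd_aboveI2)
  fix \<rho> assume "\<rho> \<in> {\<rho>. invariant_prob \<rho>}"
  then interpret prob_space \<rho> by (simp add: invariant_prob_def)
  have "norm (\<integral>x. A x \<partial>\<rho>) \<le> norm A"
  proof (rule order_trans[OF integral_norm_bound])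
    show "(\<integral>x. norm (A x) \<partial>\<rho>) \<le> norm A"
    proof (cases "integrable \<rho> (\<lambda>x. norm (A x))")
      case True
      then show ?thesis by (rule integral_le_const) (rule AE_I2, use norm_bounded[of A] in simp)
    qed (simp add: not_integrable_integral_eq)
  qed
  then show "(\<integral>x. A x \<partial>\<rho>) \<le> norm A" by simp
qed


section \<open>The operator\<close>

definition G_raw :: "C0 \<Rightarrow> C0 \<Rightarrow> circle \<Rightarrow> real" where
  "G_raw A f x = (Max ((\<lambda>y. A y + f y) ` {y. doubling y = x}) + f x) / 2"

definition G_op :: "C0 \<Rightarrow> C0_mod \<Rightarrow> C0_mod" where
  "G_op A F = to_C0_mod
     (Bcontfun (\<lambda>x. G_raw A (sup0_rep F) x - (SUP s. G_raw A (sup0_rep F) s)))"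

text \<open>The argument of the abstraction map is continuous, and it is the representative with supremum 0.\<close>

lemma G_raw_bcontfun: "(\<lambda>x. G_raw A f x - c) \<in> bcontfun"
proof (intro continuous_circle_bcontfun continuous_on_circleI)
  have "G_raw A f (to_circle a) - c =
      (max (A (to_circle (a / 2)) + f (to_circle (a / 2)))
           (A (to_circle ((a + 1) / 2)) + f (to_circle ((a + 1) / 2))) + f (to_circle a)) / 2 - c" for a
    by (simp add: G_raw_def doubling_to_circle_vimage)
  moreover have "continuous_on UNIV (\<lambda>a. (max (A (to_circle (a / 2)) + f (to_circle (a / 2)))
           (A (to_circle ((a + 1) / 2)) + f (to_circle ((a + 1) / 2))) + f (to_circle a)) / 2 - c)"
    by (intro continuous_intros continuous_on_max
        continuous_on_compose2[OF continuous_on_apply_bcontfun[of UNIV]]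
        continuous_on_compose2[OF continuous_to_circle[of UNIV]]) auto
  ultimately show "continuous_on UNIV (\<lambda>a. G_raw A f (to_circle a) - c)" by (simp only:)
qed

lemma sup0_rep_G_op:
  "sup0_rep (G_op A F) x = G_raw A (sup0_rep F) x - (SUP s. G_raw A (sup0_rep F) s)"
proof -
  let ?g = "G_raw A (sup0_rep F)"
  have "bdd_above (range ?g)"
    using G_raw_bcontfun[of A "sup0_rep F" 0] by (simp add: bcontfun_def bounded_imp_bdd_above)
  then have "(SUP x. ?g x + - (SUP s. ?g s)) = (SUP x. ?g x) + - (SUP s. ?g s)"
    by (rule SUP_add_const)
  then show ?thesis
    by (simp add: G_op_def sup0_rep.abs_eq Bcontfun_inverse G_raw_bcontfun)
qed


section \<open>The admissible pairs\<close>

definition frakA :: "(C0_mod \<times> C0_mod) set" where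
  "frakA = {(F, G). let h = sup0_rep F - sup0_rep G in
     \<forall>r. norm (F - G) = norm (h + const_bcontfun (alpha h)) \<and>
         norm (h + const_bcontfun (alpha h)) = h r + alpha h \<longrightarrow>
         h r \<noteq> h (inv_branch 1 r) \<and> h r \<noteq> h (inv_branch 2 r)}"

end

theory Submission
  imports Defs
begin

text \<open>
  The quotient norm of a class is half the oscillation \<open>max h - min h\<close> of any representative
  \<open>h\<close> (lemma \<open>norm_C0_mod_attained\<close>).
  Put \<open>h = f - g\<close>. The maxima of \<open>A + f\<close> and of \<open>A + g\<close> over the two preimages of a
  point \<open>x\<close> differ by an amount between the minimum and the maximum of \<open>h\<close> over these
  preimages. Up to one additive constant, the difference of the images of \<open>f\<close> and \<open>g\<close> at
  \<open>x\<close> is therefore an average of \<open>h x\<close> and a number in the range of values of \<open>h\<close>, and its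
  oscillation is at most that of \<open>h\<close>.

  The averaging makes the equality case rigid: if no oscillation is lost, then at a maximum point
  \<open>r\<close> of the difference of the images both averaged numbers have to equal \<open>max h\<close>. Hence \<open>h\<close>
  attains its maximum at \<open>r\<close> and also at one of the two preimages of \<open>r\<close>
  (lemma \<open>isometric_pair_repeats_max\<close>). This is exactly what membership in \<open>frakA\<close> forbids:
  a pair in \<open>frakA\<close> is strictly contracted, so the equality of norms is contradictory there.
\<close>

lemma norm_C0_mod_attained:
  fixes h :: C0
  obtains p q where "\<And>x. h x \<le> h p" "\<And>x. h q \<le> h x"
    "norm (to_C0_mod h) = (h p - h q) / 2" "norm (to_C0_mod h) = h p + alpha h"
proof -
  have cont: "continuous_on UNIV h" by simp
  obtain p where p: "\<And>x. h x \<le> h p"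
    using continuous_attains_sup[OF compact_UNIV_circle _ cont] by auto
  obtain q where q: "\<And>x. h q \<le> h x"
    using continuous_attains_inf[OF compact_UNIV_circle _ cont] by auto
  have "(SUP x. h x) = h p"
    by (rule cSup_eq_maximum) (use p in auto)
  moreover have "(INF x. h x) = h q"
    by (rule cInf_eq_minimum) (use q in auto)
  ultimately have al: "alpha h = - ((h p + h q) / 2)"
    by (simp add: alpha_def)
  have "norm (h + const_bcontfun (alpha h)) \<le> (h p - h q) / 2"
  proof (rule norm_bound)
    fix x
    show "norm ((h + const_bcontfun (alpha h)) x) \<le> (h p - h q) / 2"
      using p[of x] q[of x] by (simp add: al abs_le_iff field_simps)
  qed
  moreover have "h p + alpha h \<le> norm (h + const_bcontfun (alpha h))"
    using norm_bounded[of "h + const_bcontfun (alpha h)" p] by simp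
  moreover have "h p + alpha h = (h p - h q) / 2"
    by (simp add: al field_simps)
  ultimately show thesis
    using that[of p q] p q by (simp add: norm_to_C0_mod)
qed

lemma Max_diff_le:
  fixes a b :: "'a \<Rightarrow> real"
  assumes "finite S" "S \<noteq> {}"
  obtains y where "y \<in> S" "Max (a ` S) - Max (b ` S) \<le> a y - b y"
proof -
  have "Max (a ` S) \<in> a ` S" using assms by simp
  then obtain y where y: "y \<in> S" "Max (a ` S) = a y" by auto
  moreover have "b y \<le> Max (b ` S)" using assms y by simp
  ultimately show thesis using that[of y] by simp
qed

text \<open>
  The one-sided bound suffices: exchanging \<open>f\<close> and \<open>g\<close> gives the matching lower bound, possibly
  with a different preimage.
\<close>

lemma G_raw_diff_le:
  obtains y where "y = inv_branch 1 x \<or> y = inv_branch 2 x"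
    "G_raw A f x - G_raw A g x \<le> ((f y - g y) + (f x - g x)) / 2"
proof -
  have S: "finite {y. doubling y = x}" "{y. doubling y = x} \<noteq> {}"
    by (simp_all add: doubling_vimage)
  obtain y where y: "y \<in> {y. doubling y = x}"
    "Max ((\<lambda>y. A y + f y) ` {y. doubling y = x}) - Max ((\<lambda>y. A y + g y) ` {y. doubling y = x})
      \<le> (A y + f y) - (A y + g y)"
    by (rule Max_diff_le[OF S])
  show thesis
  proof (rule that)
    show "y = inv_branch 1 x \<or> y = inv_branch 2 x"
      using y(1) by (simp only: doubling_vimage) auto
    show "G_raw A f x - G_raw A g x \<le> ((f y - g y) + (f x - g x)) / 2"
      using y(2) by (simp add: G_raw_def field_simps)
  qed
qed

text \<open>
  The equality case of nonexpansiveness. The maximum of the difference of the images is at most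
  the average of two values of \<open>h\<close>, and its minimum is at least such an average; if its
  oscillation is that of \<open>h\<close>, all these estimates are equalities, and those at the maximum point
  give the claim.
\<close>

lemma isometric_pair_repeats_max:
  fixes A :: C0 and F G :: C0_mod
  defines "h \<equiv> sup0_rep F - sup0_rep G"
  assumes iso: "norm (G_op A F - G_op A G) = norm (F - G)"
  obtains r y where "norm (F - G) = h r + alpha h" "y = inv_branch 1 r \<or> y = inv_branch 2 r"
    "h y = h r"
proof -
  define k where "k = sup0_rep (G_op A F) - sup0_rep (G_op A G)"
  define c where "c = (SUP s. G_raw A (sup0_rep G) s) - (SUP s. G_raw A (sup0_rep F) s)"
  have k: "k x = G_raw A (sup0_rep F) x - G_raw A (sup0_rep G) x + c" for x
    by (simp add: k_def c_def sup0_rep_G_op)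
  have H: "F - G = to_C0_mod h"
    by (simp add: h_def minus_C0_mod.abs_eq[symmetric] to_C0_mod_sup0_rep)
  have K: "G_op A F - G_op A G = to_C0_mod k"
    by (simp add: k_def minus_C0_mod.abs_eq[symmetric] to_C0_mod_sup0_rep)
  obtain p q where h: "\<And>x. h x \<le> h p" "\<And>x. h q \<le> h x"
    "norm (to_C0_mod h) = (h p - h q) / 2" "norm (to_C0_mod h) = h p + alpha h"
    by (rule norm_C0_mod_attained[of h]) blast
  obtain r s where rs: "norm (to_C0_mod k) = (k r - k s) / 2"
    by (rule norm_C0_mod_attained[of k]) blast
  obtain y where y: "y = inv_branch 1 r \<or> y = inv_branch 2 r" "k r - c \<le> (h y + h r) / 2"
    by (rule G_raw_diff_le[of r A "sup0_rep F" "sup0_rep G"]) (simp add: k h_def)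
  obtain z where z: "c - k s \<le> - ((h z + h s) / 2)"
    by (rule G_raw_diff_le[of s A "sup0_rep G" "sup0_rep F"]) (simp add: k h_def field_simps)
  have "k r - k s = h p - h q"
    using iso rs h(3) by (simp add: H K)
  then have "h y = h p" "h r = h p"
    using y(2) z h(1)[of y] h(1)[of r] h(2)[of z] h(2)[of s] by argo+
  then show thesis
    using that[of r y] y(1) h(4) by (simp add: H)
qed

theorem theorem14:
  fixes A :: C0 and f0 g0 :: C0_mod
  assumes "\<exists>L. L-lipschitz_on UNIV A"
    and "\<exists>!\<mu>. maximizing A \<mu>"
    and "(f0, g0) \<in> frakA"
    and "norm (G_op A f0 - G_op A g0) = norm (f0 - g0)"
  shows "f0 = g0"
proof -
  define h where "h = sup0_rep f0 - sup0_rep g0"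
  obtain r y where r: "norm (f0 - g0) = h r + alpha h"
    and y: "y = inv_branch 1 r \<or> y = inv_branch 2 r" "h y = h r"
    using isometric_pair_repeats_max[OF assms(4)] unfolding h_def by blast
  have "norm (f0 - g0) = norm (to_C0_mod h)"
    by (simp add: h_def minus_C0_mod.abs_eq[symmetric] to_C0_mod_sup0_rep)
  then have "norm (f0 - g0) = norm (h + const_bcontfun (alpha h))"
    by (simp add: norm_to_C0_mod)
  then have "h r \<noteq> h (inv_branch 1 r) \<and> h r \<noteq> h (inv_branch 2 r)"
    using assms(3) r unfolding frakA_def h_def by (auto simp: Let_def)
  with y show ?thesis by auto
qed

end
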